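(* Let $q\in(0,1)$. If $f(z)=z+\sum_{n=2}^\infty a_nz^n$ (with $a_1=1$) belongs to $\mathcal{K}_q$ with the function $g(z)=z/(1-z^2)$, then for all $m\ge 1$ $$|a_n|\le\begin{cases}\dfrac{1-q}{1-q^n}\left(\dfrac{n}{2}(1+q)+\dfrac12(1-q)\right), & \text{if } n=2m-1,\\[3mm] \left(\dfrac{1-q^2}{1-q^n}\right)\dfrac{n}{2}, & \text{if } n=2m.\end{cases}$$
   Context: $\mathbb{D}=\{z\in\mathbb{C}:|z|<1\}$. $\mathcal{A}$ is the class of functions $f$ analytic in $\mathbb{D}$ with $f(0)=0=f'(0)-1$. $\mathcal{S}^*\subset\mathcal{A}$ is the class of univalent functions $g\in\mathcal{A}$ that are starlike with respect to the origin. For $q\in(0,1)$ and $f\in\mathcal{A}$, the $q$-difference operator is $(D_qf)(z)=\dfrac{f(z)-f(qz)}{z(1-q)}$ for $z\in\mathbb{D}\setminus\{0\}$, and $(D_qf)(0)=f'(0)$. A function $f\in\mathcal{A}$ belongs to $\mathcal{K}_q$ if there exists $g\in\mathcal{S}^*$ such that $$\left|\frac{z}{g(z)}(D_qf)(z)-\frac{1}{1-q}\right|\le\frac{1}{1-q},\quad z\in\mathbb{D}$$ (where $z/g(z)$ is given its limit value $1$ at $z=0$); one then says that $f\in\mathcal{K}_q$ with the function $g$. *)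

theory Defs
  imports "HOL-Analysis.Analysis"
begin

abbreviation unit_disc :: "complex set"
  where "unit_disc \<equiv> ball 0 1"

definition class_A :: "(complex \<Rightarrow> complex) set"
  where "class_A = {f. f analytic_on unit_disc \<and> f 0 = 0 \<and> deriv f 0 = 1}"

text \<open>The library predicate \<^const>\<open>starlike\<close> only asks for some star centre;
  here the centre is prescribed.\<close>

definition starlike_wrt :: "complex \<Rightarrow> complex set \<Rightarrow> bool"
  where "starlike_wrt c S \<longleftrightarrow> c \<in> S \<and> (\<forall>w\<in>S. closed_segment c w \<subseteq> S)"

definition class_S_star :: "(complex \<Rightarrow> complex) set"
  where "class_S_star =
    {g \<in> class_A. inj_on g unit_disc \<and> starlike_wrt 0 (g ` unit_disc)}"

definition q_diff :: "real \<Rightarrow> (complex \<Rightarrow> complex) \<Rightarrow> complex \<Rightarrow> complex"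
  where "q_diff q f z =
    (if z = 0 then deriv f 0
     else (f z - f (of_real q * z)) / (z * (1 - of_real q)))"

text \<open>The functions belonging to \<open>\<K>\<^sub>q\<close> with the function \<open>g\<close>. The quotient
  \<open>z / g z\<close> is replaced by its limit \<open>1\<close> at the origin; elsewhere in the disc
  \<open>g z \<noteq> 0\<close> by univalence.\<close>

definition class_K_with :: "real \<Rightarrow> (complex \<Rightarrow> complex) \<Rightarrow> (complex \<Rightarrow> complex) set"
  where "class_K_with q g =
    {f \<in> class_A. g \<in> class_S_star \<and>
      (\<forall>z\<in>unit_disc.
        cmod ((if z = 0 then 1 else z / g z) * q_diff q f z - of_real (1 / (1 - q)))
          \<le> 1 / (1 - q))}"

definition class_K :: "real \<Rightarrow> (complex \<Rightarrow> complex) set"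
  where "class_K q = (\<Union>g. class_K_with q g)"

end

theory Submission
  imports Defs "HOL-Complex_Analysis.Complex_Analysis"
begin

text \<open>
  Put \<open>h z = (z / g z) D\<^sub>q f(z) = (1 - z\<^sup>2) D\<^sub>q f(z)\<close>. The defining inequality of the class says
  that \<open>w = (1 - q) h - 1\<close> maps the disc into the closed unit disc, and the normalisation of
  \<open>f\<close> gives \<open>w(0) = -q\<close>. For a function bounded by 1, every later Taylor coefficient is at most
  \<open>1 - \<bar>w(0)\<bar>\<^sup>2\<close> in modulus (\<open>bounded_power_series_coeff_bound\<close>); hence
  \<open>(1 - q) \<bar>p\<^sub>k\<bar> \<le> 1 - q\<^sup>2\<close>, that is \<open>\<bar>p\<^sub>k\<bar> \<le> 1 + q\<close>, for the coefficients \<open>p\<^sub>k\<close> of \<open>h\<close> with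
  \<open>k \<ge> 1\<close>.

  On the other side, \<open>D\<^sub>q f\<close> has the coefficients
  \<open>b\<^sub>k = a\<^sub>k\<^sub>+\<^sub>1 (1 - q\<^sup>k\<^sup>+\<^sup>1) / (1 - q)\<close>, and comparing coefficients in \<open>h = (1 - z\<^sup>2) D\<^sub>q f\<close> gives
  \<open>b\<^sub>k = b\<^sub>k\<^sub>-\<^sub>2 + p\<^sub>k\<close>. So every second coefficient grows by at most \<open>1 + q\<close>, starting from
  \<open>b\<^sub>0 = 1\<close> for odd \<open>n = k + 1\<close> and from \<open>b\<^sub>1 = p\<^sub>1\<close> for even \<open>n\<close>. This difference of starting
  values is why the two parities have different bounds.

  The sharp coefficient bound for \<open>w\<close> comes from testing \<open>w\<close> against the kernel
  \<open>u\<^sup>-\<^sup>k (1 + t u\<^sup>k)\<^sup>2\<close> on circles \<open>\<bar>u\<bar> = r\<close>: the mean picks out \<open>w\<^sub>k + 2 t w\<^sub>0\<close>, while the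
  mean modulus of the kernel tends to \<open>1 + \<bar>t\<bar>\<^sup>2\<close> as \<open>r\<close> tends to 1. The best \<open>t\<close> has
  \<open>\<bar>t\<bar> = \<bar>w\<^sub>0\<bar>\<close> and the phase that makes the two terms point in the same direction.
\<close>

section \<open>Taylor coefficients of bounded holomorphic functions\<close>

text \<open>In the parameter \<open>x\<close> one has \<open>du = 2 \<pi> \<i> u dx\<close>, so contour integrals over a circle about the
  origin are means over the circle. Means are what can be estimated by a nonconstant majorant.\<close>

lemma circlepath_has_contour_integral_iff:
  "(f has_contour_integral I) (circlepath 0 r) \<longleftrightarrow>
    ((\<lambda>x. f (circlepath 0 r x) * (2 * pi * \<i> * circlepath 0 r x)) has_integral I) {0..1}"
proof -
  have "vector_derivative (circlepath 0 r) (at x) = 2 * pi * \<i> * circlepath 0 r x" for x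
    unfolding vector_derivative_circlepath by (simp add: circlepath)
  then show ?thesis
    by (simp add: has_contour_integral)
qed

lemma circle_mean_power_zero:
  assumes "k \<ge> 1"
  shows "((\<lambda>x. circlepath 0 r x ^ k) has_integral 0) {0..1}"
proof -
  have "((\<lambda>u. u ^ (k - 1)) has_contour_integral 0) (circlepath 0 r)"
    by (rule Cauchy_theorem_convex_simple[where S = UNIV])
      (auto intro!: holomorphic_intros)
  then have "((\<lambda>x. circlepath 0 r x ^ (k - 1) * (2 * pi * \<i> * circlepath 0 r x))
      has_integral 0) {0..1}"
    by (simp only: circlepath_has_contour_integral_iff)
  from has_integral_mult_right[OF this, of "1 / (2 * pi * \<i>)"]
  have "((\<lambda>x. circlepath 0 r x ^ (k - 1) * circlepath 0 r x) has_integral 0) {0..1}"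
    by (simp add: mult_ac)
  with assms show ?thesis
    by (simp flip: power_Suc2)
qed

text \<open>Parseval's identity for the two-term polynomial \<open>1 + t u\<^sup>k\<close>: the mixed term has mean zero.\<close>

lemma circle_mean_norm_square:
  assumes "k \<ge> 1" and "r \<ge> 0"
  shows "((\<lambda>x. (cmod (1 + t * circlepath 0 r x ^ k))\<^sup>2) has_integral
    (1 + (cmod t)\<^sup>2 * (r ^ k)\<^sup>2)) {0..1}"
proof -
  have "((\<lambda>x. Re (2 * t * circlepath 0 r x ^ k)) has_integral Re (2 * t * 0)) {0..1}"
    by (intro has_integral_Re has_integral_mult_right circle_mean_power_zero assms)
  moreover have "((\<lambda>x::real. 1 + (cmod t)\<^sup>2 * (r ^ k)\<^sup>2) has_integral
      (1 + (cmod t)\<^sup>2 * (r ^ k)\<^sup>2)) {0..1}"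
    using has_integral_const_real[of "1 + (cmod t)\<^sup>2 * (r ^ k)\<^sup>2" 0 1] by simp
  ultimately have "((\<lambda>x. Re (2 * t * circlepath 0 r x ^ k) + (1 + (cmod t)\<^sup>2 * (r ^ k)\<^sup>2))
      has_integral (Re (2 * t * 0) + (1 + (cmod t)\<^sup>2 * (r ^ k)\<^sup>2))) {0..1}"
    by (rule has_integral_add)
  moreover have "(cmod (1 + t * circlepath 0 r x ^ k))\<^sup>2 =
      Re (2 * t * circlepath 0 r x ^ k) + (1 + (cmod t)\<^sup>2 * (r ^ k)\<^sup>2)" for x
  proof -
    have "cmod (circlepath 0 r x) = r"
      using \<open>r \<ge> 0\<close> by (simp add: circlepath norm_mult)
    then have "(cmod (t * circlepath 0 r x ^ k))\<^sup>2 = (cmod t)\<^sup>2 * (r ^ k)\<^sup>2"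
      by (simp add: norm_mult norm_power power_mult_distrib)
    moreover have "(cmod (1 + v))\<^sup>2 = Re (2 * v) + (1 + (cmod v)\<^sup>2)" for v
      unfolding cmod_power2 by (simp add: power2_eq_square algebra_simps)
    ultimately show ?thesis
      by (metis mult.assoc)
  qed
  ultimately show ?thesis
    by simp
qed

text \<open>Multiplying \<open>f\<close> by \<open>(1 + t u\<^sup>k)\<^sup>2\<close> turns the \<open>k\<close>-th Taylor coefficient into the combination
  on the left. The factor is a square because its mean modulus is then a Parseval sum; bounding
  the factor by its maximum would only give \<open>(1 + \<bar>t\<bar>)\<^sup>2\<close>.\<close>

lemma taylor_coeff_combination_bound:
  assumes holf: "f holomorphic_on ball 0 1"
    and bound: "\<And>z. z \<in> ball 0 1 \<Longrightarrow> cmod (f z) \<le> 1"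
    and "k \<ge> 1"
  shows "cmod ((deriv ^^ k) f 0 / fact k + 2 * t * f 0) \<le> 1 + (cmod t)\<^sup>2"
proof -
  let ?c = "(deriv ^^ k) f 0 / fact k"
  have on_circle: "r ^ k * cmod (?c + 2 * t * f 0) \<le> 1 + (cmod t)\<^sup>2 * (r ^ k)\<^sup>2"
    if r: "0 < r" "r < 1" for r
  proof -
    let ?\<gamma> = "circlepath 0 r"
    have cont: "continuous_on (cball 0 r) f"
      using r by (intro holomorphic_on_imp_continuous_on holomorphic_on_subset[OF holf]) auto
    have hol: "f holomorphic_on ball 0 r"
      using r by (intro holomorphic_on_subset[OF holf]) auto
    note cauchy = Cauchy_has_contour_integral_higher_derivative_circlepath[OF cont hol, of 0]
    \<comment> \<open>The three terms of \<open>(1 + t u\<^sup>k)\<^sup>2 = 1 + 2 t u\<^sup>k + t\<^sup>2 u\<^sup>2\<^sup>k\<close>, each times \<open>f u / u\<^sup>k\<^sup>+\<^sup>1\<close>.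
      The last one has no pole, so it contributes nothing.\<close>
    have I1: "((\<lambda>u. f u / u ^ Suc k) has_contour_integral (2 * pi * \<i> * ?c)) ?\<gamma>"
      using cauchy[of k] r by (simp add: field_simps)
    have I2: "((\<lambda>u. 2 * t * (f u / u)) has_contour_integral (2 * t * (2 * pi * \<i> * f 0))) ?\<gamma>"
      using cauchy[of 0] r by (intro has_contour_integral_lmul) simp
    have I3: "((\<lambda>u. t\<^sup>2 * (f u * u ^ (k - 1))) has_contour_integral (t\<^sup>2 * 0)) ?\<gamma>"
      using r by (intro has_contour_integral_lmul Cauchy_theorem_convex_simple[where S = "ball 0 1"])
        (auto intro!: holomorphic_intros holf)
    have "((\<lambda>u. f u / u ^ Suc k + 2 * t * (f u / u) + t\<^sup>2 * (f u * u ^ (k - 1)))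
        has_contour_integral (2 * pi * \<i> * (?c + 2 * t * f 0))) ?\<gamma>"
      using has_contour_integral_add[OF has_contour_integral_add[OF I1 I2] I3]
      by (simp add: algebra_simps)
    then have "((\<lambda>u. f u * (1 + t * u ^ k)\<^sup>2 / u ^ Suc k)
        has_contour_integral (2 * pi * \<i> * (?c + 2 * t * f 0))) ?\<gamma>"
    proof (rule has_contour_integral_eq)
      fix u assume "u \<in> path_image ?\<gamma>"
      with r have "u \<noteq> 0" by auto
      obtain j where "k = Suc j"
        using \<open>k \<ge> 1\<close> by (cases k) auto
      with \<open>u \<noteq> 0\<close> show "f u / u ^ Suc k + 2 * t * (f u / u) + t\<^sup>2 * (f u * u ^ (k - 1)) =
          f u * (1 + t * u ^ k)\<^sup>2 / u ^ Suc k"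
        by (simp add: field_simps power2_eq_square)
    qed
    then have "((\<lambda>x. f (?\<gamma> x) * (1 + t * ?\<gamma> x ^ k)\<^sup>2 / ?\<gamma> x ^ Suc k * (2 * pi * \<i> * ?\<gamma> x))
        has_integral (2 * pi * \<i> * (?c + 2 * t * f 0))) {0..1}"
      by (simp only: circlepath_has_contour_integral_iff)
    from has_integral_mult_right[OF this, of "1 / (2 * pi * \<i>)"]
    have "((\<lambda>x. f (?\<gamma> x) * (1 + t * ?\<gamma> x ^ k)\<^sup>2 / ?\<gamma> x ^ k)
        has_integral (?c + 2 * t * f 0)) {0..1}"
    proof (rule has_integral_eq_rhs[OF has_integral_eq, rotated])
      fix x :: real
      have "?\<gamma> x \<noteq> 0"
        using r by (simp add: circlepath)
      then show "1 / (2 * pi * \<i>) *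
          (f (?\<gamma> x) * (1 + t * ?\<gamma> x ^ k)\<^sup>2 / ?\<gamma> x ^ Suc k * (2 * pi * \<i> * ?\<gamma> x)) =
          f (?\<gamma> x) * (1 + t * ?\<gamma> x ^ k)\<^sup>2 / ?\<gamma> x ^ k"
        by (simp add: field_simps)
    qed simp
    moreover have "((\<lambda>x. (cmod (1 + t * ?\<gamma> x ^ k))\<^sup>2 / r ^ k) has_integral
        ((1 + (cmod t)\<^sup>2 * (r ^ k)\<^sup>2) / r ^ k)) {0..1}"
      using has_integral_divide[OF circle_mean_norm_square] r \<open>k \<ge> 1\<close> by simp
    moreover have "cmod (f (?\<gamma> x) * (1 + t * ?\<gamma> x ^ k)\<^sup>2 / ?\<gamma> x ^ k) \<le>
        (cmod (1 + t * ?\<gamma> x ^ k))\<^sup>2 / r ^ k" for x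
    proof -
      have g: "cmod (?\<gamma> x) = r"
        using r by (simp add: circlepath norm_mult)
      then have "cmod (f (?\<gamma> x)) \<le> 1"
        using r by (intro bound) simp
      then show ?thesis
        using r by (simp add: norm_mult norm_divide norm_power g divide_right_mono mult_left_le_one_le)
    qed
    ultimately have "cmod (?c + 2 * t * f 0) \<le> (1 + (cmod t)\<^sup>2 * (r ^ k)\<^sup>2) / r ^ k"
      using integral_norm_bound_integral[of _ "{0..1::real}"]
      by (metis (mono_tags, lifting) has_integral_iff)
    then show ?thesis
      using r by (simp add: field_simps)
  qed
  show ?thesis
  proof (rule tendsto_le)
    show "((\<lambda>r. r ^ k * cmod (?c + 2 * t * f 0)) \<longlongrightarrow> cmod (?c + 2 * t * f 0)) (at_left (1::real))"
      by (auto intro!: tendsto_eq_intros)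
    show "((\<lambda>r. 1 + (cmod t)\<^sup>2 * (r ^ k)\<^sup>2) \<longlongrightarrow> 1 + (cmod t)\<^sup>2) (at_left (1::real))"
      by (auto intro!: tendsto_eq_intros)
    show "\<forall>\<^sub>F r in at_left 1. r ^ k * cmod (?c + 2 * t * f 0) \<le> 1 + (cmod t)\<^sup>2 * (r ^ k)\<^sup>2"
      using eventually_at_left_real[of 0 "1::real"]
      by (auto elim!: eventually_mono intro!: on_circle)
  qed simp
qed

text \<open>The classical coefficient form of the Schwarz-Pick inequality. Minimising
  \<open>1 + \<bar>t\<bar>\<^sup>2 - 2 \<bar>t\<bar> \<bar>c\<^sub>0\<bar>\<close>, the bound that the previous lemma gives for \<open>\<bar>c\<^sub>k\<bar>\<close> when
  \<open>t c\<^sub>0\<close> has the phase of \<open>c\<^sub>k\<close>, leads to \<open>\<bar>t\<bar> = \<bar>c\<^sub>0\<bar>\<close>.\<close>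

lemma bounded_power_series_coeff_bound:
  fixes c :: "nat \<Rightarrow> complex"
  assumes sums: "\<And>z. z \<in> ball 0 1 \<Longrightarrow> (\<lambda>n. c n * z ^ n) sums f z"
    and bound: "\<And>z. z \<in> ball 0 1 \<Longrightarrow> cmod (f z) \<le> 1"
    and "k \<ge> 1"
  shows "cmod (c k) \<le> 1 - (cmod (c 0))\<^sup>2"
proof -
  have f0: "f 0 = c 0"
    using sums[of 0] by (simp add: powser_sums_zero_iff)
  have hol: "f holomorphic_on ball 0 1"
    using sums by (intro power_series_holomorphic) auto
  have "f has_fps_expansion Abs_fps c"
  proof (rule has_fps_expansionI)
    have "\<forall>\<^sub>F z in nhds 0. z \<in> ball (0::complex) 1"
      by (intro eventually_nhds_in_open) auto
    then show "\<forall>\<^sub>F z in nhds 0. (\<lambda>n. fps_nth (Abs_fps c) n * z ^ n) sums f z"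
      by eventually_elim (simp add: sums)
  qed
  then have ck: "(deriv ^^ k) f 0 / fact k = c k"
    using fps_nth_fps_expansion[of f "Abs_fps c" k] by simp
  show ?thesis
  proof (cases "c k = 0")
    \<comment> \<open>There is no phase to align with; only \<open>\<bar>c\<^sub>0\<bar> \<le> 1\<close> is left to show.\<close>
    case True
    have "cmod (c 0) \<le> 1"
      using bound[of 0] f0 by simp
    with True show ?thesis
      by (simp add: power_le_one)
  next
    case False
    let ?t = "cnj (c 0) * sgn (c k)"
    have "cmod ?t = cmod (c 0)"
      using False by (simp add: norm_mult norm_sgn)
    moreover have "c k + 2 * ?t * c 0 = of_real (cmod (c k) + 2 * (cmod (c 0))\<^sup>2) * sgn (c k)"
    proof -
      have "c k = of_real (cmod (c k)) * sgn (c k)"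
        by (simp add: sgn_eq)
      moreover have "cnj (c 0) * c 0 = of_real ((cmod (c 0))\<^sup>2)"
        by (metis complex_norm_square mult.commute)
      then have "2 * ?t * c 0 = 2 * of_real ((cmod (c 0))\<^sup>2) * sgn (c k)"
        by (metis (no_types, lifting) mult.assoc mult.commute)
      ultimately show ?thesis
        by (simp add: algebra_simps)
    qed
    then have "cmod (c k + 2 * ?t * c 0) = cmod (c k) + 2 * (cmod (c 0))\<^sup>2"
      using False by (simp add: norm_mult norm_sgn del: of_real_add)
    moreover have "cmod (c k + 2 * ?t * c 0) \<le> 1 + (cmod ?t)\<^sup>2"
      using taylor_coeff_combination_bound[OF hol bound \<open>k \<ge> 1\<close>, of ?t] by (simp add: ck f0)
    ultimately show ?thesis
      by simp
  qed
qed

section \<open>The power series of the \<open>q\<close>-difference quotient\<close>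

text \<open>The operator multiplies \<open>z\<^sup>n\<close> by the \<open>q\<close>-number \<open>(1 - q\<^sup>n) / (1 - q)\<close> and lowers the exponent.
  At 0 the operator has a separate value, which the hypothesis on the derivative ties to the series.\<close>

lemma q_diff_sums:
  fixes a :: "nat \<Rightarrow> complex"
  assumes q: "0 < q" "q < 1"
    and sums: "\<And>z. z \<in> unit_disc \<Longrightarrow> (\<lambda>n. a (Suc n) * z ^ Suc n) sums f z"
    and deriv: "deriv f 0 = a 1"
    and z: "z \<in> unit_disc"
  shows "(\<lambda>n. a (Suc n) * of_real ((1 - q ^ Suc n) / (1 - q)) * z ^ n) sums q_diff q f z"
proof (cases "z = 0")
  case True
  moreover have "a (Suc 0) * of_real ((1 - q ^ Suc 0) / (1 - q)) = q_diff q f 0"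
    using q deriv by (simp add: q_diff_def)
  ultimately show ?thesis
    using powser_sums_zero[of "\<lambda>n. a (Suc n) * of_real ((1 - q ^ Suc n) / (1 - q))"] by simp
next
  case False
  have "cmod (of_real q * z) < 1"
    using z q mult_strict_mono[of q 1 "cmod z" 1] by (simp add: norm_mult)
  then have "(\<lambda>n. a (Suc n) * z ^ Suc n - a (Suc n) * (of_real q * z) ^ Suc n)
      sums (f z - f (of_real q * z))"
    using z by (intro sums_diff sums) auto
  then have "(\<lambda>n. (a (Suc n) * z ^ Suc n - a (Suc n) * (of_real q * z) ^ Suc n) /
      (z * (1 - of_real q))) sums q_diff q f z"
    using False by (simp add: q_diff_def sums_divide)
  moreover have "(a (Suc n) * z ^ Suc n - a (Suc n) * (of_real q * z) ^ Suc n) /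
      (z * (1 - of_real q)) = a (Suc n) * of_real ((1 - q ^ Suc n) / (1 - q)) * z ^ n" for n
  proof -
    have "(1 - of_real q :: complex) \<noteq> 0"
      using q by (metis eq_iff_diff_eq_0 less_irrefl of_real_eq_1_iff)
    with False show ?thesis
      by (simp add: field_simps power_mult_distrib)
  qed
  ultimately show ?thesis
    by simp
qed

lemma sums_times_one_minus_square:
  fixes b :: "nat \<Rightarrow> complex"
  assumes "(\<lambda>n. b n * z ^ n) sums s"
  shows "(\<lambda>n. (b n - (if n < 2 then 0 else b (n - 2))) * z ^ n) sums ((1 - z\<^sup>2) * s)"
proof -
  let ?d = "\<lambda>n. (if n < 2 then 0 else b (n - 2)) * z ^ n"
  have "(\<lambda>n. ?d (n + 2)) sums (z\<^sup>2 * s)"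
    using sums_mult[OF assms, of "z\<^sup>2"] by (simp add: power2_eq_square mult_ac)
  then have "?d sums (z\<^sup>2 * s)"
    by (subst (asm) sums_iff_shift) (simp add: numeral_2_eq_2)
  from sums_diff[OF assms this] show ?thesis
    by (simp add: algebra_simps)
qed

section \<open>The coefficient bounds\<close>

lemma sums_of_bounded_steps_bound:
  fixes b :: "nat \<Rightarrow> complex"
  assumes b0: "cmod (b 0) = 1"
    and b1: "cmod (b 1) \<le> M"
    and step: "\<And>n. cmod (b (n + 2) - b n) \<le> M"
  shows "cmod (b (2 * m)) \<le> 1 + real m * M"
    and "cmod (b (2 * m + 1)) \<le> real (m + 1) * M"
proof -
  have incr: "cmod (b (n + 2)) \<le> cmod (b n) + M" for n
    using step[of n] norm_triangle_sub[of "b (n + 2)" "b n"] by linarith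
  show "cmod (b (2 * m)) \<le> 1 + real m * M"
  proof (induction m)
    case (Suc m)
    then show ?case
      using incr[of "2 * m"] by (simp add: algebra_simps)
  qed (simp add: b0)
  show "cmod (b (2 * m + 1)) \<le> real (m + 1) * M"
  proof (induction m)
    case (Suc m)
    then show ?case
      using incr[of "2 * m + 1"] by (simp add: algebra_simps)
  qed (use b1 in simp)
qed

theorem corollary3p6:
  fixes q :: real and f :: "complex \<Rightarrow> complex" and a :: "nat \<Rightarrow> complex"
  assumes "0 < q" and "q < 1"
    and "f \<in> class_K_with q (\<lambda>z. z / (1 - z\<^sup>2))"
    and "a 1 = 1"
    and "\<forall>z\<in>unit_disc. (\<lambda>n. a (n + 2) * z ^ (n + 2)) sums (f z - z)"
  shows "\<forall>m\<ge>1. \<forall>n.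
    (n = 2 * m - 1 \<longrightarrow>
      cmod (a n) \<le> (1 - q) / (1 - q ^ n) * (real n / 2 * (1 + q) + 1 / 2 * (1 - q))) \<and>
    (n = 2 * m \<longrightarrow>
      cmod (a n) \<le> (1 - q\<^sup>2) / (1 - q ^ n) * (real n / 2))"
proof -
  define b where "b n = a (Suc n) * of_real ((1 - q ^ Suc n) / (1 - q))" for n
  define p where "p n = b n - (if n < 2 then 0 else b (n - 2))" for n
  define h where "h z = (1 - z\<^sup>2) * q_diff q f z" for z
  have deriv: "deriv f 0 = a 1"
    using assms by (simp add: class_K_with_def class_A_def)
  have b0: "b 0 = 1"
    using assms by (simp add: b_def)

  have f_sums: "(\<lambda>n. a (Suc n) * z ^ Suc n) sums f z" if "z \<in> unit_disc" for z
  proof -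
    have "(\<lambda>n. a (Suc (Suc n)) * z ^ Suc (Suc n)) sums (f z - a (Suc 0) * z ^ Suc 0)"
      using assms that by (simp add: numeral_2_eq_2)
    then show ?thesis
      by (subst (asm) sums_Suc_iff) simp
  qed
  have h_sums: "(\<lambda>n. p n * z ^ n) sums h z" if "z \<in> unit_disc" for z
    using sums_times_one_minus_square[OF q_diff_sums[OF \<open>0 < q\<close> \<open>q < 1\<close> f_sums deriv that]]
    unfolding p_def h_def b_def .
  have h_bound: "cmod (h z - of_real (1 / (1 - q))) \<le> 1 / (1 - q)" if "z \<in> unit_disc" for z
  proof -
    \<comment> \<open>\<open>z / g z\<close> extends to a polynomial, so the origin is no exception in what follows.\<close>
    have quotient: "(if z = 0 then 1 else z / (z / (1 - z\<^sup>2))) = 1 - z\<^sup>2"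
      by simp
    have "cmod ((if z = 0 then 1 else z / (z / (1 - z\<^sup>2))) * q_diff q f z -
        of_real (1 / (1 - q))) \<le> 1 / (1 - q)"
      using assms(3) that unfolding class_K_with_def by blast
    then show ?thesis
      unfolding h_def quotient .
  qed

  \<comment> \<open>The coefficients of \<open>w = (1 - q) h - 1\<close>, the function bounded by 1.\<close>
  define c where "c n = of_real (1 - q) * p n - (if n = 0 then 1 else 0)" for n
  have c_sums: "(\<lambda>n. c n * z ^ n) sums (of_real (1 - q) * h z - 1)" if "z \<in> unit_disc" for z
  proof -
    have "(\<lambda>n. (if n = 0 then 1 else 0) * z ^ n) sums 1"
      using powser_sums_if[of 0 z] by simp
    from sums_diff[OF sums_mult[OF h_sums[OF that], of "of_real (1 - q)"] this] show ?thesis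
      by (simp add: c_def algebra_simps)
  qed
  have c_bound: "cmod (of_real (1 - q) * h z - 1) \<le> 1" if "z \<in> unit_disc" for z
  proof -
    have "of_real (1 - q) * h z - 1 = of_real (1 - q) * (h z - of_real (1 / (1 - q)))"
      using \<open>q < 1\<close> by (simp add: right_diff_distrib flip: of_real_mult of_real_diff)
    also have "cmod \<dots> = (1 - q) * cmod (h z - of_real (1 / (1 - q)))"
      using \<open>q < 1\<close> by (simp only: norm_mult norm_of_real)
    also have "\<dots> \<le> (1 - q) * (1 / (1 - q))"
      using \<open>q < 1\<close> by (intro mult_left_mono h_bound that) auto
    finally show ?thesis
      using \<open>q < 1\<close> by simp
  qed
  have c0: "c 0 = - of_real q"
    by (simp add: c_def p_def b0)
  have p_bound: "cmod (p k) \<le> 1 + q" if "k \<ge> 1" for k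
  proof -
    have "cmod (c k) \<le> 1 - q\<^sup>2"
      using bounded_power_series_coeff_bound[OF c_sums c_bound that] by (simp add: c0)
    moreover have "cmod (c k) = (1 - q) * cmod (p k)"
      using \<open>q < 1\<close> that by (simp add: c_def norm_mult del: of_real_diff)
    ultimately have "(1 - q) * cmod (p k) \<le> (1 - q) * (1 + q)"
      by (simp add: power2_eq_square algebra_simps)
    with \<open>q < 1\<close> show ?thesis
      by simp
  qed

  have "cmod (b 1) \<le> 1 + q"
    using p_bound[of 1] by (simp add: p_def)
  moreover have "cmod (b (n + 2) - b n) \<le> 1 + q" for n
    using p_bound[of "n + 2"] by (simp add: p_def)
  ultimately have b_bound: "cmod (b (2 * j)) \<le> 1 + real j * (1 + q)"
      "cmod (b (2 * j + 1)) \<le> real (j + 1) * (1 + q)" for j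
    using sums_of_bounded_steps_bound[of b "1 + q"] by (simp_all add: b0)

  have a_eq: "cmod (a (Suc n)) = (1 - q) / (1 - q ^ Suc n) * cmod (b n)" for n
  proof -
    have "q ^ Suc n < 1"
      using assms by (intro power_Suc_less_one) auto
    then show ?thesis
      using \<open>q < 1\<close> by (simp add: b_def norm_mult del: of_real_diff of_real_divide power_Suc)
  qed
  have a_le: "cmod (a (Suc n)) \<le> (1 - q) / (1 - q ^ Suc n) * B" if "cmod (b n) \<le> B" for n B
    unfolding a_eq
    using that assms
    by (intro mult_left_mono divide_nonneg_nonneg) (auto intro!: power_le_one simp del: power_Suc)

  show ?thesis
  proof (intro allI impI conjI)
    fix m n :: nat
    assume "1 \<le> m" "n = 2 * m - 1"
    then obtain j where n: "n = Suc (2 * j)"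
      by (cases m) auto
    have "cmod (a n) \<le> (1 - q) / (1 - q ^ n) * (1 + real j * (1 + q))"
      using a_le[OF b_bound(1)[of j]] unfolding n .
    also have "1 + real j * (1 + q) = real n / 2 * (1 + q) + 1 / 2 * (1 - q)"
      by (simp add: n field_simps)
    finally show "cmod (a n) \<le> (1 - q) / (1 - q ^ n) * (real n / 2 * (1 + q) + 1 / 2 * (1 - q))" .
  next
    fix m n :: nat
    assume "1 \<le> m" "n = 2 * m"
    then obtain j where n: "n = Suc (2 * j + 1)"
      by (cases m) auto
    have "cmod (a n) \<le> (1 - q) / (1 - q ^ n) * (real (j + 1) * (1 + q))"
      using a_le[OF b_bound(2)[of j]] n by simp
    also have "\<dots> = ((1 - q) * (real (j + 1) * (1 + q))) / (1 - q ^ n)"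
      by simp
    also have "(1 - q) * (real (j + 1) * (1 + q)) = (1 - q\<^sup>2) * (real n / 2)"
      by (simp add: n power2_eq_square field_simps)
    also have "\<dots> / (1 - q ^ n) = (1 - q\<^sup>2) / (1 - q ^ n) * (real n / 2)"
      by simp
    finally show "cmod (a n) \<le> (1 - q\<^sup>2) / (1 - q ^ n) * (real n / 2)" .
  qed
qed

end
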